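(* Let $(\mathbf{k}(n))_{n\in\mathbb{N}}=((k_1(n),\ldots,k_{d(n)}(n)))_{n\in\mathbb{N}}$ be an injective sequence of admissible multi-indices (i.e. $\mathbf{k}(n)\ne\mathbf{k}(m)$ for $n\neq m$). If $0$ is not an accumulation point of the sequence $(t(\mathbf{k}(n)))_{n\in\mathbb{N}}$, then there exist an infinite subset $\mathbb{D}\subseteq\mathbb{N}$ and a positive integer $d$ such that (i) $d(n)=d$ for all $n\in\mathbb{D}$, and (ii) if $d>1$, there are positive integers $k_1,\ldots,k_{d-1}$ with $k_i(n)=k_i$ for all $n\in\mathbb{D}$ and all $1\leq i<d$.
   Context: An admissible multi-index is a finite sequence $\mathbf{k}=(k_1,\ldots,k_d)$, $d\ge1$, of positive integers with $k_1>1$. The multiple $t$-value is $t(\mathbf{k})=\sum_{m_1>\cdots>m_d>0}\prod_{i=1}^d (2m_i-1)^{-k_i}$. $\mathbb{N}=\{1,2,3,\ldots\}$. *)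

theory Defs
  imports "HOL-Analysis.Analysis"
begin

text \<open>A multi-index (k_1, ..., k_d) is the list [k_1, ..., k_d]; since lists are indexed from 0,
  the entry k_i is \<open>ks ! (i - 1)\<close>.\<close>

definition admissible :: "nat list \<Rightarrow> bool" where
  "admissible ks \<longleftrightarrow> ks \<noteq> [] \<and> (\<forall>k \<in> set ks. 0 < k) \<and> 1 < hd ks"

definition decreasing_tuples :: "nat \<Rightarrow> nat list set" where
  "decreasing_tuples d = {ms. length ms = d \<and> sorted_wrt (>) ms \<and> (\<forall>m \<in> set ms. 0 < m)}"

text \<open>For admissible \<open>ks\<close> the series has positive terms and converges, so the unordered sum
  is the value of the series under any order of summation.\<close>

definition multiple_t :: "nat list \<Rightarrow> real" where
  "multiple_t ks = (\<Sum>\<^sub>\<infinity>ms \<in> decreasing_tuples (length ks).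
     \<Prod>i<length ks. 1 / (2 * real (ms ! i) - 1) ^ (ks ! i))"

text \<open>Accumulation points of a sequence indexed by the positive integers; the value at index 0
  is irrelevant. Terms are counted by index, not by value.\<close>

definition accumulation_point :: "(nat \<Rightarrow> 'a::topological_space) \<Rightarrow> 'a \<Rightarrow> bool" where
  "accumulation_point x a \<longleftrightarrow> (\<forall>U. open U \<longrightarrow> a \<in> U \<longrightarrow> infinite {n \<in> {1..}. x n \<in> U})"

end

theory Submission imports Defs
begin

text \<open>Every term of the series for an admissible multi-index of depth \<open>d\<close> is dominated by the
  corresponding term for \<open>(2, 1, ..., 1)\<close>. The finite sums of the latter series are at most
  \<open>6 (2/3) ^ (d - 1)\<close>: the elementary symmetric sums of the numbers \<open>1/(2j - 1)\<close> are coefficients of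
  the product of the \<open>1 + x/(2j - 1)\<close>, taken at \<open>x = 3/2\<close>, and the remaining sum over the largest
  index telescopes. So the depth is bounded along a sequence of values bounded away from 0. All
  indices but the last are at least 2, so an entry \<open>k_i\<close> with \<open>i < d\<close> gains a factor
  \<open>3 ^ (2 - k_i)\<close>, whence these entries are bounded too, and the pigeonhole principle applies.\<close>

section \<open>Truncated index tuples and the generating product\<close>

definition bounded_tuples :: "nat \<Rightarrow> nat \<Rightarrow> nat list set" where
  "bounded_tuples d N = {ms \<in> decreasing_tuples d. \<forall>m \<in> set ms. m \<le> N}"

definition odd_weight :: "nat list \<Rightarrow> real" where
  "odd_weight ms = (\<Prod>m\<leftarrow>ms. 1 / (2 * real m - 1))"

text \<open>The constant \<open>3/2\<close> stands for a number x with 1 < x < 2: above 1 so that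
  \<open>(1/x) ^ d\<close> decays, below 2 so that the sum over the largest index
  telescopes.\<close>

definition odd_prod :: "nat \<Rightarrow> real" where
  "odd_prod N = (\<Prod>j=1..N. 1 + (3/2) / (2 * real j - 1))"

lemma odd_prod_0 [simp]: "odd_prod 0 = 1"
  by (simp add: odd_prod_def)

lemma odd_prod_Suc: "odd_prod (Suc N) = odd_prod N * (1 + (3/2) / (2 * real N + 1))"
  by (simp add: odd_prod_def)

lemma odd_prod_pos: "0 < odd_prod N"
  by (induction N) (simp_all add: odd_prod_Suc add_pos_nonneg)

lemma bounded_tuples_0 [simp]: "bounded_tuples 0 N = {[]}"
  by (auto simp: bounded_tuples_def decreasing_tuples_def)

lemma bounded_tuples_Suc_0 [simp]: "bounded_tuples (Suc d) 0 = {}"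
  by (auto simp: bounded_tuples_def decreasing_tuples_def length_Suc_conv)

text \<open>The head is the largest entry, so the split is by whether it equals
  \<open>Suc N\<close>. This recursion drives both inductions on \<open>N\<close> below.\<close>

lemma bounded_tuples_Suc_Suc:
  "bounded_tuples (Suc d) (Suc N) =
     bounded_tuples (Suc d) N \<union> (#) (Suc N) ` bounded_tuples d N" (is "?L = ?R")
proof
  show "?L \<subseteq> ?R"
  proof
    fix ms assume ms: "ms \<in> ?L"
    then obtain m xs where eq: "ms = m # xs"
      by (auto simp: bounded_tuples_def decreasing_tuples_def length_Suc_conv)
    show "ms \<in> ?R"
    proof (cases "m = Suc N")
      case True
      then have "xs \<in> bounded_tuples d N"
        using ms by (auto simp: eq bounded_tuples_def decreasing_tuples_def)
      then show ?thesis using eq True by blast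
    next
      case False
      then show ?thesis
        using ms by (fastforce simp: eq bounded_tuples_def decreasing_tuples_def)
    qed
  qed
  show "?R \<subseteq> ?L"
    by (fastforce simp: bounded_tuples_def decreasing_tuples_def)
qed

lemma finite_bounded_tuples: "finite (bounded_tuples d N)"
  by (rule finite_subset[OF _ finite_lists_length_eq[of "{..N}" d]])
     (auto simp: bounded_tuples_def decreasing_tuples_def)

section \<open>Finite sums of the dominating series\<close>

lemma sum_bounded_tuples_Suc_Suc:
  fixes f :: "nat list \<Rightarrow> real"
  shows "sum f (bounded_tuples (Suc d) (Suc N)) =
    sum f (bounded_tuples (Suc d) N) + (\<Sum>ms\<in>bounded_tuples d N. f (Suc N # ms))"
proof -
  have "bounded_tuples (Suc d) N \<inter> (#) (Suc N) ` bounded_tuples d N = {}"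
    by (auto simp: bounded_tuples_def)
  then show ?thesis
    by (simp add: bounded_tuples_Suc_Suc sum.union_disjoint finite_bounded_tuples
        sum.reindex inj_on_def)
qed

text \<open>Tuples with head \<open>Suc N\<close> contribute the sum of depth \<open>d - 1\<close>
  divided by \<open>2 * N + 1\<close>. Since \<open>(2/3) ^ (d - 1) = (2/3) ^ d * (3/2)\<close>, the
  two bounds add up to the next factor of \<open>odd_prod\<close>.\<close>

lemma sum_odd_weight_le: "(\<Sum>ms\<in>bounded_tuples d N. odd_weight ms) \<le> (2/3) ^ d * odd_prod N"
proof (induction N arbitrary: d)
  case 0
  show ?case by (cases d) (simp_all add: odd_weight_def)
next
  case (Suc N)
  show ?case
  proof (cases d)
    case 0
    have "1 \<le> odd_prod (Suc N)"
      unfolding odd_prod_def by (rule prod_ge_1) auto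
    then show ?thesis using 0 by (simp add: odd_weight_def)
  next
    case (Suc d')
    have "(\<Sum>ms\<in>bounded_tuples d' N. odd_weight (Suc N # ms)) =
        (\<Sum>ms\<in>bounded_tuples d' N. odd_weight ms) / (2 * real N + 1)"
      by (simp add: odd_weight_def sum_divide_distrib add.commute)
    also have "\<dots> \<le> (2/3) ^ d' * odd_prod N / (2 * real N + 1)"
      by (intro divide_right_mono Suc.IH) simp
    finally have "(\<Sum>ms\<in>bounded_tuples d (Suc N). odd_weight ms) \<le>
        (2/3) ^ d * odd_prod N + (2/3) ^ d' * odd_prod N / (2 * real N + 1)"
      using Suc.IH[of d] unfolding Suc sum_bounded_tuples_Suc_Suc by linarith
    also have "\<dots> = (2/3) ^ d * odd_prod (Suc N)"
      by (simp add: Suc odd_prod_Suc distrib_left) (simp add: divide_simps)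
    finally show ?thesis .
  qed
qed

text \<open>With \<open>a = 2 * N + 1\<close> the right side is
  \<open>3 * odd_prod N / (a * (a + 2))\<close>: the difference leaves the factor 2 - 3/2 = 1/2, and
  6 turns it into 3. Then \<open>a + 2 \<le> 3 * a\<close> suffices.\<close>

lemma odd_prod_telescope:
  "odd_prod N / (2 * real N + 1) ^ 2 \<le>
     6 * (odd_prod N / (2 * real N + 1) - odd_prod (Suc N) / (2 * real (Suc N) + 1))"
proof -
  define a where "a = 2 * real N + 1"
  have a: "1 \<le> a" "2 * real (Suc N) + 1 = a + 2" by (auto simp: a_def)
  have "1 / a ^ 2 = 3 / (a * (3 * a))"
    by (simp add: power2_eq_square)
  also have "\<dots> \<le> 3 / (a * (a + 2))"
    using a by (intro divide_left_mono mult_left_mono) auto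
  finally have "odd_prod N * (1 / a ^ 2) \<le> odd_prod N * (3 / (a * (a + 2)))"
    using odd_prod_pos[of N] by (intro mult_left_mono) auto
  also have "odd_prod N * (3 / (a * (a + 2))) = 6 * (odd_prod N / a - odd_prod N * (1 + (3/2) / a) / (a + 2))"
  proof -
    have "a \<noteq> 0" "a + 2 \<noteq> 0" using a(1) by auto
    then show ?thesis by (simp add: divide_simps) (simp add: algebra_simps)
  qed
  finally show ?thesis
    unfolding odd_prod_Suc a_def[symmetric] a(2) by simp
qed

text \<open>Dividing by the odd number of the head gives it exponent 2, so the summand is the term
  for (2, 1, ..., 1). The tails below a new head are bounded by \<open>sum_odd_weight_le\<close>,
  and the resulting bounds telescope.\<close>

lemma sum_odd_weight_hd_le:
  "(\<Sum>ms\<in>bounded_tuples (Suc d) N. odd_weight ms / (2 * real (hd ms) - 1)) \<le>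
     6 * (2/3) ^ d * (1 - odd_prod N / (2 * real N + 1))"
proof (induction N)
  case 0
  show ?case by simp
next
  case (Suc N)
  have "(\<Sum>ms\<in>bounded_tuples d N. odd_weight (Suc N # ms) / (2 * real (hd (Suc N # ms)) - 1)) =
      (\<Sum>ms\<in>bounded_tuples d N. odd_weight ms) / (2 * real N + 1) ^ 2"
    by (simp add: odd_weight_def sum_divide_distrib power2_eq_square add.commute)
  also have "\<dots> \<le> (2/3) ^ d * odd_prod N / (2 * real N + 1) ^ 2"
    by (intro divide_right_mono sum_odd_weight_le) simp
  also have "\<dots> = (2/3) ^ d * (odd_prod N / (2 * real N + 1) ^ 2)"
    by simp
  also have "\<dots> \<le> (2/3) ^ d *
      (6 * (odd_prod N / (2 * real N + 1) - odd_prod (Suc N) / (2 * real (Suc N) + 1)))"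
    by (intro mult_left_mono odd_prod_telescope) simp
  finally show ?case
    using Suc.IH unfolding sum_bounded_tuples_Suc_Suc by (simp add: algebra_simps)
qed

section \<open>From finite sums to multiple t-values\<close>

lemma finite_subset_bounded_tuples:
  assumes "finite F" "F \<subseteq> decreasing_tuples d"
  obtains N where "F \<subseteq> bounded_tuples d N"
proof
  have "finite (\<Union>(set ` F))" using assms by simp
  then show "F \<subseteq> bounded_tuples d (Max (\<Union>(set ` F)))"
    using assms by (auto simp: bounded_tuples_def intro!: Max_ge)
qed

lemma odd_weight_hd_nonneg:
  assumes "ms \<in> decreasing_tuples (Suc d)"
  shows "0 \<le> odd_weight ms / (2 * real (hd ms) - 1)"
proof -
  have ge: "1 \<le> m" if "m \<in> set ms" for m
    using assms that by (force simp: decreasing_tuples_def)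
  moreover have "hd ms \<in> set ms"
    using assms by (intro hd_in_set) (auto simp: decreasing_tuples_def)
  then have "1 \<le> hd ms" by (rule ge)
  ultimately show ?thesis
    unfolding odd_weight_def
    by (intro divide_nonneg_nonneg prod_list_nonneg) fastforce+
qed

text \<open>The factor \<open>c\<close> is the gain over the series for (2, 1, ..., 1): it is 1 in
  the depth bound and a power of 1/3 in the entry bound.\<close>

lemma multiple_t_le:
  assumes len: "length ks = Suc d" and "0 \<le> c"
    and dom: "\<And>ms. ms \<in> decreasing_tuples (Suc d) \<Longrightarrow>
      (\<Prod>i<length ks. 1 / (2 * real (ms ! i) - 1) ^ (ks ! i)) \<le>
        c * (odd_weight ms / (2 * real (hd ms) - 1))"
  shows "multiple_t ks \<le> c * (6 * (2/3) ^ d)"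
proof -
  let ?f = "\<lambda>ms. \<Prod>i<length ks. 1 / (2 * real (ms ! i) - 1) ^ (ks ! i)"
  let ?g = "\<lambda>ms. odd_weight ms / (2 * real (hd ms) - 1)"
  have fin: "sum ?f F \<le> c * (6 * (2/3) ^ d)"
    if F: "finite F" "F \<subseteq> decreasing_tuples (Suc d)" for F
  proof -
    obtain N where N: "F \<subseteq> bounded_tuples (Suc d) N"
      using finite_subset_bounded_tuples[OF F] .
    have "sum ?f F \<le> c * sum ?g F"
      unfolding sum_distrib_left using F by (intro sum_mono dom) auto
    also have "\<dots> \<le> c * sum ?g (bounded_tuples (Suc d) N)"
      using N \<open>0 \<le> c\<close> finite_bounded_tuples
      by (intro mult_left_mono sum_mono2 odd_weight_hd_nonneg[of _ d])
         (auto simp: bounded_tuples_def)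
    also have "\<dots> \<le> c * (6 * (2/3) ^ d * (1 - odd_prod N / (2 * real N + 1)))"
      using \<open>0 \<le> c\<close> by (intro mult_left_mono sum_odd_weight_hd_le)
    also have "\<dots> \<le> c * (6 * (2/3) ^ d * 1)"
      using \<open>0 \<le> c\<close> odd_prod_pos[of N] by (intro mult_left_mono) auto
    finally show ?thesis by simp
  qed
  show ?thesis
  proof (cases "?f summable_on decreasing_tuples (Suc d)")
    case True
    then show ?thesis
      unfolding multiple_t_def len by (intro infsum_le_finite_sums) (use fin len in auto)
  next
    \<comment> \<open>Here \<open>infsum\<close> has the default value 0, which also satisfies the
      bound.\<close>
    case False
    then show ?thesis
      using \<open>0 \<le> c\<close> by (simp add: multiple_t_def len infsum_not_exists)
  qed
qed

section \<open>Termwise comparison with (2, 1, ..., 1)\<close>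

lemma odd_entry_ge:
  assumes "ms \<in> decreasing_tuples d" "i < d"
  shows "1 \<le> 2 * real (ms ! i) - 1"
proof -
  have "0 < ms ! i" using assms by (auto simp: decreasing_tuples_def)
  then show ?thesis by linarith
qed

lemma odd_entry_ge_3:
  assumes "ms \<in> decreasing_tuples d" "Suc i < d"
  shows "3 \<le> 2 * real (ms ! i) - 1"
proof -
  have "ms ! Suc i < ms ! i" "0 < ms ! Suc i"
    using assms by (auto simp: decreasing_tuples_def sorted_wrt_iff_nth_less)
  then have "2 \<le> ms ! i" by linarith
  then show ?thesis by linarith
qed

text \<open>The conditional is the entry of (2, 1, ..., 1), the entrywise smallest admissible
  multi-index of its depth.\<close>

lemma admissible_nth_ge:
  assumes "admissible ks" "i < length ks"
  shows "(if i = 0 then 2 else 1) \<le> ks ! i"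
proof -
  have "0 < ks ! i" "1 < ks ! 0"
    using assms by (auto simp: admissible_def hd_conv_nth)
  then show ?thesis by auto
qed

text \<open>Each exponent splits into the entry of (2, 1, ..., 1) and the excess over it; the
  subtraction of naturals is exact by \<open>admissible_nth_ge\<close>.\<close>

lemma term_eq_odd_weight:
  assumes "admissible ks" "length ks = Suc d" "ms \<in> decreasing_tuples (Suc d)"
  shows "(\<Prod>i<Suc d. 1 / (2 * real (ms ! i) - 1) ^ (ks ! i)) =
    (\<Prod>i<Suc d. 1 / (2 * real (ms ! i) - 1) ^ (ks ! i - (if i = 0 then 2 else 1))) *
      (odd_weight ms / (2 * real (hd ms) - 1))"
proof -
  let ?a = "\<lambda>i. 2 * real (ms ! i) - 1"
  let ?e = "\<lambda>i::nat. if i = 0 then 2 else 1 :: nat"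
  have len: "length ms = Suc d" using assms by (auto simp: decreasing_tuples_def)
  have "odd_weight ms = (\<Prod>i<Suc d. 1 / ?a i)"
    unfolding odd_weight_def prod.list_conv_set_nth
    by (rule prod.cong) (use len in auto)
  moreover have "hd ms = ms ! 0"
    using len by (intro hd_conv_nth) auto
  ultimately have "odd_weight ms / (2 * real (hd ms) - 1) = (\<Prod>i<Suc d. 1 / ?a i) / ?a 0"
    by simp
  \<comment> \<open>The extra division by \<open>?a 0\<close> raises the exponent at index 0 from 1
    to 2.\<close>
  also have "\<dots> = (\<Prod>i<Suc d. 1 / ?a i ^ ?e i)"
    unfolding prod.lessThan_Suc_shift by (simp add: power2_eq_square)
  finally have g: "odd_weight ms / (2 * real (hd ms) - 1) = (\<Prod>i<Suc d. 1 / ?a i ^ ?e i)" .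
  show ?thesis
    unfolding g prod.distrib[symmetric]
  proof (rule prod.cong)
    fix i assume "i \<in> {..<Suc d}"
    then have "?e i \<le> ks ! i"
      using admissible_nth_ge[of ks i] assms by simp
    then show "1 / ?a i ^ (ks ! i) = 1 / ?a i ^ (ks ! i - ?e i) * (1 / ?a i ^ ?e i)"
      by (metis (no_types, lifting) le_add_diff_inverse2 mult_1 power_add times_divide_times_eq)
  qed simp
qed

section \<open>Bounds in terms of the depth and of a single entry\<close>

lemma multiple_t_le_depth:
  assumes adm: "admissible ks" and len: "length ks = Suc d"
  shows "multiple_t ks \<le> 6 * (2/3) ^ d"
proof -
  have "multiple_t ks \<le> 1 * (6 * (2/3) ^ d)"
  proof (rule multiple_t_le[OF len])
    fix ms assume ms: "ms \<in> decreasing_tuples (Suc d)"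
    show "(\<Prod>i<length ks. 1 / (2 * real (ms ! i) - 1) ^ (ks ! i)) \<le>
        1 * (odd_weight ms / (2 * real (hd ms) - 1))"
      unfolding len term_eq_odd_weight[OF adm len ms]
    \<comment> \<open>The excess factors are at most 1, as the odd numbers are at least 1.\<close>
    proof (intro mult_right_mono odd_weight_hd_nonneg[OF ms] prod_le_1 conjI)
      fix i assume "i \<in> {..<Suc d}"
      then have "1 \<le> 2 * real (ms ! i) - 1"
        using odd_entry_ge[OF ms] by simp
      then show "0 \<le> 1 / (2 * real (ms ! i) - 1) ^ (ks ! i - (if i = 0 then 2 else 1))"
          and "1 / (2 * real (ms ! i) - 1) ^ (ks ! i - (if i = 0 then 2 else 1)) \<le> 1"
        by (auto simp: divide_le_eq_1 intro!: one_le_power)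
    qed
  qed simp
  then show ?thesis by simp
qed

text \<open>Index \<open>j\<close> is not the last, so its odd number is at least 3 and its excess
  factor alone yields the power of 1/3; the other excess factors are at most 1.\<close>

lemma multiple_t_le_entry:
  assumes adm: "admissible ks" and len: "length ks = Suc d" and j: "j < d"
  shows "multiple_t ks \<le> 6 * (1/3) ^ (ks ! j - 2)"
proof -
  have "multiple_t ks \<le> (1/3) ^ (ks ! j - 2) * (6 * (2/3) ^ d)"
  proof (rule multiple_t_le[OF len])
    fix ms assume ms: "ms \<in> decreasing_tuples (Suc d)"
    define h where
      "h i = 1 / (2 * real (ms ! i) - 1) ^ (ks ! i - (if i = 0 then 2 else 1))" for i
    have h: "0 \<le> h i" "h i \<le> 1" if "i < Suc d" for i
      using odd_entry_ge[OF ms that] unfolding h_def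
      by (auto simp: divide_le_eq_1 intro!: one_le_power)
    have a: "3 \<le> 2 * real (ms ! j) - 1"
      using odd_entry_ge_3[OF ms] j by simp
    \<comment> \<open>The excess is \<open>ks ! j - 2\<close> for \<open>j = 0\<close> and
      \<open>ks ! j - 1\<close> otherwise; the smaller exponent covers both cases.\<close>
    have "(3::real) ^ (ks ! j - 2) \<le> 3 ^ (ks ! j - (if j = 0 then 2 else 1))"
      by (intro power_increasing) auto
    also have "\<dots> \<le> (2 * real (ms ! j) - 1) ^ (ks ! j - (if j = 0 then 2 else 1))"
      using a by (intro power_mono) auto
    finally have "h j \<le> (1/3) ^ (ks ! j - 2)"
      unfolding h_def power_one_over using a by (intro divide_left_mono) auto
    moreover have "(\<Prod>i<Suc d. h i) \<le> h j"
    proof -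
      have "(\<Prod>i<Suc d. h i) = h j * (\<Prod>i\<in>{..<Suc d} - {j}. h i)"
        using j by (intro prod.remove) auto
      also have "\<dots> \<le> h j * 1"
        using h j by (intro mult_left_mono prod_le_1) auto
      finally show ?thesis by simp
    qed
    ultimately have "(\<Prod>i<Suc d. h i) \<le> (1/3) ^ (ks ! j - 2)"
      by linarith
    then show "(\<Prod>i<length ks. 1 / (2 * real (ms ! i) - 1) ^ (ks ! i)) \<le>
        (1/3) ^ (ks ! j - 2) * (odd_weight ms / (2 * real (hd ms) - 1))"
      unfolding len term_eq_odd_weight[OF adm len ms] h_def
      by (intro mult_right_mono odd_weight_hd_nonneg[OF ms])
  qed simp
  also have "\<dots> \<le> (1/3) ^ (ks ! j - 2) * (6 * 1)"
    by (intro mult_left_mono power_le_one) auto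
  finally show ?thesis by simp
qed

section \<open>Finiteness and the pigeonhole principle\<close>

lemma multiple_t_nonneg: "0 \<le> multiple_t ks"
  unfolding multiple_t_def
proof (rule infsum_nonneg)
  fix ms assume "ms \<in> decreasing_tuples (length ks)"
  then show "0 \<le> (\<Prod>i<length ks. 1 / (2 * real (ms ! i) - 1) ^ (ks ! i))"
    by (intro prod_nonneg) (use odd_entry_ge[of ms "length ks"] in fastforce)
qed

text \<open>\<open>butlast\<close> discards the one entry without a bound: its summation index may
  be 1, where a larger exponent gains nothing. What remains has bounded length and bounded
  entries.\<close>

lemma finite_butlast_multiple_t_ge:
  assumes "0 < e"
  shows "finite (butlast ` {ks. admissible ks \<and> e \<le> multiple_t ks})"
proof -
  \<comment> \<open>\<open>M\<close> and \<open>K\<close> push the depth bound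
    \<open>6 * (2/3) ^ M\<close> and the entry bound \<open>6 * (1/3) ^ K\<close> below
    \<open>e\<close>.\<close>
  obtain M :: nat where M: "(2/3::real) ^ M < e / 6"
    using real_arch_pow_inv[of "e / 6" "2/3"] assms by auto
  obtain K :: nat where K: "(1/3::real) ^ K < e / 6"
    using real_arch_pow_inv[of "e / 6" "1/3"] assms by auto
  have "butlast ks \<in> {xs. set xs \<subseteq> {..K + 2} \<and> length xs \<le> M}"
    if ks: "admissible ks" "e \<le> multiple_t ks" for ks
  proof -
    obtain d where d: "length ks = Suc d"
      using ks by (cases ks) (auto simp: admissible_def)
    have "d \<le> M"
    proof (rule ccontr)
      assume "\<not> d \<le> M"
      then have "(2/3::real) ^ d \<le> (2/3) ^ M"
        by (intro power_decreasing) auto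
      then show False
        using multiple_t_le_depth[OF ks(1) d] ks(2) M by linarith
    qed
    moreover have "ks ! j \<le> K + 2" if "j < d" for j
    proof (rule ccontr)
      assume "\<not> ks ! j \<le> K + 2"
      then have "(1/3::real) ^ (ks ! j - 2) \<le> (1/3) ^ K"
        by (intro power_decreasing) auto
      then show False
        using multiple_t_le_entry[OF ks(1) d that] ks(2) K by linarith
    qed
    ultimately show ?thesis
      using d by (auto simp: in_set_conv_nth nth_butlast)
  qed
  then show ?thesis
    by (intro finite_subset[OF _ finite_lists_length_le[of "{..K + 2}" M]]) auto
qed

theorem theorem2p2:
  fixes k :: "nat \<Rightarrow> nat list"
  assumes "\<forall>n \<in> {1..}. admissible (k n)"
    and "inj_on k {1..}"
    and "\<not> accumulation_point (\<lambda>n. multiple_t (k n)) 0"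
  shows "\<exists>D d. D \<subseteq> {1..} \<and> infinite D \<and> 0 < d \<and>
    (\<forall>n \<in> D. length (k n) = d) \<and>
    (1 < d \<longrightarrow> (\<exists>c :: nat \<Rightarrow> nat. (\<forall>i. 1 \<le> i \<and> i < d \<longrightarrow> 0 < c i) \<and>
      (\<forall>n \<in> D. \<forall>i. 1 \<le> i \<and> i < d \<longrightarrow> k n ! (i - 1) = c i)))"
proof -
  obtain U where U: "open U" "0 \<in> U" "finite {n \<in> {1..}. multiple_t (k n) \<in> U}"
    using assms(3) by (auto simp: accumulation_point_def)
  obtain e where e: "0 < e" "ball 0 e \<subseteq> U"
    using U by (auto simp: open_contains_ball)
  define I where "I = {1..} - {n \<in> {1..}. multiple_t (k n) \<in> U}"
  have "infinite I"
    unfolding I_def using U(3) by (intro Diff_infinite_finite) (auto simp: infinite_Ici)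
  have ge: "e \<le> multiple_t (k n)" if "n \<in> I" for n
  proof -
    \<comment> \<open>Outside the ball the absolute value is at least \<open>e\<close>, and
      nonnegativity removes the absolute value.\<close>
    have "multiple_t (k n) \<notin> ball 0 e" using that e(2) by (auto simp: I_def)
    then show ?thesis using multiple_t_nonneg[of "k n"] by simp
  qed
  have adm: "admissible (k n)" if "n \<in> I" for n
    using that assms(1) by (auto simp: I_def)
  have "finite ((\<lambda>n. butlast (k n)) ` I)"
    by (rule finite_subset[OF _ finite_butlast_multiple_t_ge[OF e(1)]]) (use ge adm in auto)
  \<comment> \<open>Some value of \<open>butlast\<close> occurs infinitely often; it fixes the depth
    and all entries but the last.\<close>
  then obtain a where a: "a \<in> I" "infinite {n \<in> I. butlast (k n) = butlast (k a)}"
    using pigeonhole_infinite[OF \<open>infinite I\<close>] by blast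
  define D where "D = {n \<in> I. butlast (k n) = butlast (k a)}"
  have pos: "0 < length (k n)" if "n \<in> I" for n
    using adm[OF that] by (simp add: admissible_def)
  have len: "length (k n) = length (k a)" if "n \<in> D" for n
  proof -
    have "length (butlast (k n)) = length (butlast (k a))" "n \<in> I"
      using that by (auto simp: D_def)
    \<comment> \<open>Both lengths are positive, so equality after the truncated subtraction of 1
      implies equality.\<close>
    then show ?thesis using pos[of n] pos[OF a(1)] unfolding length_butlast by linarith
  qed
  have nth: "k n ! (i - 1) = k a ! (i - 1)" if "n \<in> D" "1 \<le> i" "i < length (k a)" for n i
  proof -
    have "butlast (k n) ! (i - 1) = butlast (k a) ! (i - 1)"
      using that by (simp add: D_def)
    then show ?thesis using that len by (simp add: nth_butlast)
  qed
  have "0 < k a ! (i - 1)" if "1 \<le> i" "i < length (k a)" for i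
    using adm[OF a(1)] that by (auto simp: admissible_def)
  moreover have "D \<subseteq> {1..}" by (auto simp: D_def I_def)
  moreover have "infinite D" using a(2) by (simp add: D_def)
  ultimately show ?thesis
    using len nth pos[OF a(1)]
    by (intro exI[of _ D] exI[of _ "length (k a)"] conjI impI exI[of _ "\<lambda>i. k a ! (i - 1)"]) auto
qed

end
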